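(* Let $f:\mathbb{R}^n\to\mathbb{R}$ be a convex function having a global minimum point $x^*$, and suppose that $f$ has an $L$-continuous gradient for some $L>0$. Let $\rho>0$. Then the gradient method $$\dot x = -\rho\,\frac{\nabla f(x)}{\|\nabla f(x)\|^2}$$ reaches the minimum point $x^*$ in a finite time; that is, for every initial condition $x(0)\in\mathbb{R}^n$ there is a finite time at which the trajectory $x(t)$ reaches $x^*$.
   Context: $\|\cdot\|$ is the Euclidean norm and $\langle\cdot,\cdot\rangle$ the inner product on $\mathbb{R}^n$; $\dot x$ denotes the derivative with respect to time $t$. A function $f$ whose gradient exists is said to have an $L$-continuous gradient ($L>0$) if $\langle \nabla f(\theta_1)-\nabla f(\theta_2),\theta_1-\theta_2\rangle\le L\|\theta_1-\theta_2\|^2$ for all $\theta_1,\theta_2$ in the domain of $f$. The right-hand side of the dynamics is undefined where $\nabla f(x)=0$; the trajectory is understood to be continuous and to satisfy the equation until it reaches the minimum point.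
   Formalization: The trajectory is shown to reach some global minimum point in finite time, and x* itself when x* is the only global minimum point; with several minimum points, reaching a prescribed x* from every x(0) is false (e.g. f(x)=max(0,|x|-1)^2, x*=0, x(0)=2). *)

theory Defs
  imports "HOL-Analysis.Analysis"
begin

definition gradient :: "('a::real_inner \<Rightarrow> real) \<Rightarrow> 'a \<Rightarrow> 'a" where
  "gradient f x = (THE D. GDERIV f x :> D)"

lemma gradient_eqI:
  assumes "GDERIV f x :> D"
  shows "gradient f x = D"
  unfolding gradient_def
proof (rule the_equality, rule assms)
  fix D' assume "GDERIV f x :> D'"
  with assms have "(\<lambda>h. inner h D') = (\<lambda>h. inner h D)"
    unfolding gderiv_def by (rule has_derivative_unique[rotated])
  then have "inner (D' - D) D' = inner (D' - D) D"
    by metis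
  then have "inner (D' - D) (D' - D) = 0"
    by (simp add: inner_diff_right)
  then show "D' = D" by simp
qed

text \<open>
  A one-sided condition on the gradient, not Lipschitz continuity of the gradient (although
  the two coincide for convex functions on the whole space).
\<close>
definition L_continuous_gradient :: "real \<Rightarrow> ('a::real_inner \<Rightarrow> real) \<Rightarrow> bool" where
  "L_continuous_gradient L f \<longleftrightarrow>
     (\<forall>x. \<exists>D. GDERIV f x :> D) \<and>
     (\<forall>x y. inner (gradient f x - gradient f y) (x - y) \<le> L * (norm (x - y))\<^sup>2)"

abbreviation global_min_point :: "('a \<Rightarrow> real) \<Rightarrow> 'a \<Rightarrow> bool" where
  "global_min_point f z \<equiv> is_arg_min f (\<lambda>_. True) z"

text \<open>
  The differential equation is required at a time \<open>t\<close> only if no minimum point has been visited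
  up to and including \<open>t\<close>. For convex \<open>f\<close> the gradient is therefore nonzero wherever the
  equation is imposed, so the convention \<open>a / 0 = 0\<close> plays no role. From the first visit on, only
  continuity is required.
\<close>
definition gradient_trajectory ::
    "real \<Rightarrow> ('a::real_inner \<Rightarrow> real) \<Rightarrow> 'a \<Rightarrow> (real \<Rightarrow> 'a) \<Rightarrow> bool" where
  "gradient_trajectory \<rho> f x0 x \<longleftrightarrow>
     x 0 = x0 \<and> continuous_on {0..} x \<and>
     (\<forall>t\<ge>0. (\<forall>s\<in>{0..t}. \<not> global_min_point f (x s)) \<longrightarrow>
        (x has_vector_derivative
           - (\<rho> *\<^sub>R (gradient f (x t) /\<^sub>R (norm (gradient f (x t)))\<^sup>2))) (at t within {0..}))"

end

theory Submission
  imports Defs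
begin

text \<open>
  \<^bold>\<open>Reaching a minimum.\<close> Along a solution of the normalised equation,
  \<open>d/dt f(x) = \<langle>\<nabla>f(x), x'\<rangle> = - \<rho>\<close>, so \<open>f\<close> decreases at constant speed and, being bounded below,
  the trajectory cannot avoid the minimum points beyond time \<open>(f(x\<^sub>0) - min f) / \<rho>\<close>. Convexity enters
  only in that a point with zero gradient is a minimum
  (\<open>gradient_trajectory_reaches_minimum\<close>).

  \<^bold>\<open>Existence of a trajectory.\<close> The right-hand side blows up at the minimum, so the equation is not
  solved directly. It has the same orbits as the gradient flow \<open>y' = - \<nabla>f(y)\<close>, whose right-hand side
  is globally Lipschitz: for convex \<open>f\<close> the one-sided condition on the gradient improves to Lipschitz
  continuity (\<open>convex_gradient_Lipschitz\<close>). Hence \<open>y\<close> exists on the whole half-line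
  (\<open>Lipschitz_ode_global_solution\<close>). The flow never arrives at a minimum point in finite time
  (\<open>gradient_flow_distance_lower_bound\<close>), but it converges to one, say \<open>p\<close>
  (\<open>gradient_flow_converges\<close>). Therefore \<open>s \<mapsto> (f(x\<^sub>0) - f(y(s))) / \<rho>\<close> is an increasing bijection
  of \<open>[0, \<infinity>)\<close> onto \<open>[0, T)\<close> with positive derivative, where \<open>T = (f(x\<^sub>0) - f(p)) / \<rho>\<close>. Using it as
  the new time turns \<open>y\<close> into a solution of the normalised equation on \<open>[0, T)\<close>, which extends
  continuously by the constant \<open>p\<close> (\<open>gradient_trajectory_exists\<close>).
\<close>

section \<open>Calculus on a half-line\<close>

lemma mean_value_half_line:
  fixes g g' :: "real \<Rightarrow> real"
  assumes deriv: "\<And>s. s \<ge> 0 \<Longrightarrow> (g has_real_derivative g' s) (at s within {0..})"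
    and "0 \<le> a" "a < b"
  obtains c where "a < c" "c < b" "g b - g a = g' c * (b - a)"
proof -
  have "(g has_derivative (\<lambda>h. g' s * h)) (at s within {a..b})" if "a \<le> s" "s \<le> b" for s
    using deriv[of s] that \<open>0 \<le> a\<close>
    by (auto simp: has_field_derivative_def intro: has_derivative_subset)
  from mvt_simple[OF \<open>a < b\<close> this] show ?thesis
    using that by auto
qed

lemma nonincreasing_half_line:
  fixes g g' :: "real \<Rightarrow> real"
  assumes deriv: "\<And>s. s \<ge> 0 \<Longrightarrow> (g has_real_derivative g' s) (at s within {0..})"
    and nonpos: "\<And>s. s \<ge> 0 \<Longrightarrow> g' s \<le> 0"
    and "0 \<le> a" "a \<le> b"
  shows "g b \<le> g a"
proof (cases "a = b")
  case False
  with \<open>a \<le> b\<close> have "a < b" by simp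
  then obtain c where "a < c" "c < b" "g b - g a = g' c * (b - a)"
    using mean_value_half_line[OF deriv \<open>0 \<le> a\<close>] by blast
  moreover have "g' c * (b - a) \<le> 0"
    using nonpos[of c] \<open>a < c\<close> \<open>0 \<le> a\<close> \<open>a < b\<close> by (intro mult_nonpos_nonneg) auto
  ultimately show ?thesis by simp
qed simp

text \<open>
  The change of time scale. Since \<open>g\<close> increases to its limit \<open>T\<close> without attaining it, the half-line
  is mapped homeomorphically onto \<open>[0, T)\<close>, and the inverse function theorem applies up to and
  including the end point \<open>0\<close> because all derivatives are taken within the intervals.
\<close>

lemma increasing_half_line_inverse:
  fixes g g' :: "real \<Rightarrow> real"
  assumes deriv: "\<And>s. s \<ge> 0 \<Longrightarrow> (g has_real_derivative g' s) (at s within {0..})"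
    and pos: "\<And>s. s \<ge> 0 \<Longrightarrow> g' s > 0"
    and g0: "g 0 = 0" and lim: "(g \<longlongrightarrow> T) at_top"
  obtains \<sigma> where
    "\<And>t. t \<in> {0..<T} \<Longrightarrow> \<sigma> t \<ge> 0"
    "\<And>s. s \<ge> 0 \<Longrightarrow> \<sigma> (g s) = s"
    "\<And>t. t \<in> {0..<T} \<Longrightarrow> (\<sigma> has_real_derivative inverse (g' (\<sigma> t))) (at t within {0..<T})"
    "filterlim \<sigma> at_top (at T within {0..<T})"
proof -
  have less: "g a < g b" if ab: "0 \<le> a" "a < b" for a b
  proof -
    obtain c where "a < c" "c < b" "g b - g a = g' c * (b - a)"
      using mean_value_half_line[OF deriv ab] by blast
    moreover have "g' c * (b - a) > 0"
      using pos[of c] \<open>a < c\<close> ab by (intro mult_pos_pos) auto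
    ultimately show ?thesis by simp
  qed
  have cont: "continuous_on {0..} g"
    using deriv by (auto simp: continuous_on_eq_continuous_within intro: DERIV_continuous)
  have inj: "inj_on g {0..}"
    by (rule inj_onI) (metis atLeast_iff less less_irrefl linorder_neqE_linordered_idom)
  have below: "g s < T" if "s \<ge> 0" for s
  proof -
    \<comment> \<open>The limit bounds only weakly; going one unit further makes the bound at \<open>s\<close> strict.\<close>
    have "\<forall>\<^sub>F u in at_top. g (s + 1) \<le> g u"
      using eventually_gt_at_top[of "s + 1"]
      by eventually_elim (use less[of "s + 1"] that in force)
    then have "g (s + 1) \<le> T"
      by (intro tendsto_lowerbound[OF lim]) auto
    with less[of s "s + 1"] that show ?thesis by simp
  qed
  have image: "g ` {0..} = {0..<T}"
  proof
    show "g ` {0..} \<subseteq> {0..<T}"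
      using below less[of 0] g0 by (force simp: le_less)
    show "{0..<T} \<subseteq> g ` {0..}"
    proof
      fix t assume t: "t \<in> {0..<T}"
      have "\<forall>\<^sub>F u in at_top. t < g u"
        using order_tendstoD(1)[OF lim] t by simp
      then have "\<forall>\<^sub>F u in at_top. t < g u \<and> u \<ge> 0"
        using eventually_ge_at_top[of 0] by (rule eventually_conj)
      then obtain u where "t < g u" "u \<ge> 0"
        using eventually_happens[of _ "at_top :: real filter"] by auto
      moreover have "continuous_on {0..u} g"
        using cont by (rule continuous_on_subset) auto
      ultimately show "t \<in> g ` {0..}"
        using IVT'[of g 0 t u] t g0 by force
    qed
  qed
  have "path_connected {0::real..}"
    by (simp add: convex_imp_path_connected)
  from homeomorphism_into_1d[OF this cont image inj]
  obtain \<sigma> where \<sigma>: "homeomorphism {0..} {0..<T} g \<sigma>" by blast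
  have \<sigma>g: "\<sigma> (g s) = s" if "s \<ge> 0" for s
    using homeomorphism_apply1[OF \<sigma>] that by simp
  have g\<sigma>: "g (\<sigma> t) = t" and \<sigma>0: "\<sigma> t \<ge> 0" if "t \<in> {0..<T}" for t
    using homeomorphism_apply2[OF \<sigma> that] homeomorphism_image2[OF \<sigma>] that by auto
  have cont\<sigma>: "continuous_on {0..<T} \<sigma>"
    using \<sigma> by (simp add: homeomorphism_def)
  have d\<sigma>: "(\<sigma> has_real_derivative inverse (g' (\<sigma> t))) (at t within {0..<T})"
    if t: "t \<in> {0..<T}" for t
  proof -
    have "(\<sigma> has_derivative (\<lambda>h. inverse (g' (\<sigma> t)) * h)) (at (g (\<sigma> t)) within g ` {0..})"
    proof (rule has_derivative_inverse_within)
      show "(g has_derivative (\<lambda>h. g' (\<sigma> t) * h)) (at (\<sigma> t) within {0..})"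
        using deriv[OF \<sigma>0[OF t]] by (simp add: has_field_derivative_def)
      show "continuous (at (g (\<sigma> t)) within g ` {0..}) \<sigma>"
        unfolding image g\<sigma>[OF t] using cont\<sigma> t by (auto simp: continuous_on_eq_continuous_within)
      show "(*) (inverse (g' (\<sigma> t))) \<circ> (*) (g' (\<sigma> t)) = id"
        using pos[OF \<sigma>0[OF t]] by (auto simp: fun_eq_iff)
    qed (use \<sigma>0[OF t] \<sigma>g in \<open>auto intro: bounded_linear.linear bounded_linear_mult_right\<close>)
    then show ?thesis
      by (simp add: has_field_derivative_def image g\<sigma>[OF t])
  qed
  have "filterlim \<sigma> at_top (at T within {0..<T})"
    unfolding filterlim_at_top_ge[where c = 0]
  proof (intro allI impI)
    fix Z :: real assume Z: "Z \<ge> 0"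
    have "\<forall>\<^sub>F t in at T within {0..<T}. t > g Z"
      using order_tendstoD(1)[OF tendsto_ident_at below[OF Z]] .
    moreover have "\<forall>\<^sub>F t in at T within {0..<T}. t \<in> {0..<T}"
      by (auto simp: eventually_at_filter)
    ultimately show "\<forall>\<^sub>F t in at T within {0..<T}. Z \<le> \<sigma> t"
    proof eventually_elim
      case (elim t)
      show ?case
      proof (rule ccontr)
        assume "\<not> Z \<le> \<sigma> t"
        with less[of "\<sigma> t" Z] \<sigma>0[OF elim(2)] g\<sigma>[OF elim(2)] elim(1) show False by simp
      qed
    qed
  qed
  with that \<sigma>0 \<sigma>g d\<sigma> show ?thesis by blast
qed

lemma GDERIV_chain_within:
  assumes "GDERIV f (c s) :> D" and "(c has_vector_derivative v) (at s within S)"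
  shows "((\<lambda>s. f (c s)) has_real_derivative inner v D) (at s within S)"
proof -
  have "(f \<circ> c has_derivative (\<lambda>h. inner h D) \<circ> (\<lambda>h. h *\<^sub>R v)) (at s within S)"
    using assms by (intro diff_chain_within)
      (auto simp: gderiv_def has_vector_derivative_def intro: has_derivative_at_withinI)
  then show ?thesis
    by (simp add: has_field_derivative_def o_def mult_commute_abs)
qed

section \<open>Convex functions with one-sidedly bounded gradient\<close>

text \<open>Restricting to the line through \<open>x\<close> and \<open>y\<close> reduces this to convex functions of one variable.\<close>

lemma convex_above_tangent_plane:
  fixes f :: "'a::real_inner \<Rightarrow> real"
  assumes "convex_on UNIV f" and "GDERIV f x :> D"
  shows "f x + inner D (y - x) \<le> f y"
proof -
  let ?c = "\<lambda>t. x + t *\<^sub>R (y - x)"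
  have "convex_on UNIV (\<lambda>t. f (?c t))"
  proof (rule convex_onI)
    fix t a b :: real assume t: "0 < t" "t < 1"
    have "?c ((1 - t) *\<^sub>R a + t *\<^sub>R b) = (1 - t) *\<^sub>R ?c a + t *\<^sub>R ?c b"
      by (simp add: algebra_simps)
    then show "f (?c ((1 - t) *\<^sub>R a + t *\<^sub>R b)) \<le> (1 - t) * f (?c a) + t * f (?c b)"
      using convex_onD[OF assms(1), of t "?c a" "?c b"] t by simp
  qed simp
  moreover have "((\<lambda>t. f (?c t)) has_real_derivative inner (y - x) D) (at 0)"
    by (rule GDERIV_chain_within) (use assms(2) in \<open>auto intro!: derivative_eq_intros\<close>)
  ultimately have "f (?c 1) - f (?c 0) \<ge> inner (y - x) D * (1 - 0)"
    by (intro convex_on_imp_above_tangent[where A = UNIV]) auto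
  then show ?thesis by (simp add: inner_commute)
qed

lemma stationary_point_iff_minimum:
  fixes f :: "'a::real_inner \<Rightarrow> real"
  assumes "convex_on UNIV f" and "GDERIV f x :> D"
  shows "D = 0 \<longleftrightarrow> global_min_point f x"
proof
  assume "D = 0"
  with convex_above_tangent_plane[OF assms] show "global_min_point f x"
    by (auto simp: is_arg_min_linorder)
next
  assume min: "global_min_point f x"
  have "((\<lambda>t. f (x + t *\<^sub>R D)) has_real_derivative inner D D) (at 0)"
    by (rule GDERIV_chain_within) (use assms(2) in \<open>auto intro!: derivative_eq_intros\<close>)
  then have "inner D D = 0"
    by (rule DERIV_local_min[where d = 1]) (use min in \<open>auto simp: is_arg_min_linorder\<close>)
  then show "D = 0" by simp
qed

text \<open>
  The one-sided condition with the points \<open>x + t h\<close> and \<open>x\<close> says that along the segment the slope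
  of \<open>f\<close> exceeds its initial value by at most \<open>L t \<parallel>h\<parallel>\<^sup>2\<close>; the quadratic term is the integral of
  this excess.
\<close>

lemma descent_inequality:
  fixes f :: "'a::real_inner \<Rightarrow> real"
  assumes grad: "\<And>x. GDERIV f x :> D x"
    and L: "\<And>x y. inner (D x - D y) (x - y) \<le> L * (norm (x - y))\<^sup>2"
  shows "f y \<le> f x + inner (D x) (y - x) + L / 2 * (norm (y - x))\<^sup>2"
proof -
  define h where "h = y - x"
  let ?\<phi> = "\<lambda>t. f (x + t *\<^sub>R h) - t * inner (D x) h - L / 2 * t\<^sup>2 * (norm h)\<^sup>2"
  have "?\<phi> 1 \<le> ?\<phi> 0"
  proof (rule nonincreasing_half_line[where g = ?\<phi>])
    fix t :: real assume t: "t \<ge> 0"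
    have "((\<lambda>t. f (x + t *\<^sub>R h)) has_real_derivative inner h (D (x + t *\<^sub>R h))) (at t within {0..})"
      by (rule GDERIV_chain_within[OF grad]) (auto intro!: derivative_eq_intros)
    then show "(?\<phi> has_real_derivative
        inner (D (x + t *\<^sub>R h) - D x) h - L * t * (norm h)\<^sup>2) (at t within {0..})"
      by (auto intro!: derivative_eq_intros simp: inner_diff_left inner_diff_right inner_commute)
    show "inner (D (x + t *\<^sub>R h) - D x) h - L * t * (norm h)\<^sup>2 \<le> 0"
    proof (cases "t = 0")
      case False
      have "t * inner (D (x + t *\<^sub>R h) - D x) h \<le> t * (L * t * (norm h)\<^sup>2)"
        using L[of "x + t *\<^sub>R h" x] by (simp add: power_mult_distrib power2_eq_square mult_ac)
      with False t show ?thesis by simp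
    qed simp
  qed auto
  then show ?thesis by (simp add: h_def algebra_simps)
qed

text \<open>
  The Baillon--Haddad argument. Sandwiching \<open>f(z)\<close> between the tangent plane at \<open>x\<close> (convexity) and
  the quadratic upper bound at \<open>y\<close> (descent inequality) shows that \<open>f(y)\<close> lies above the tangent
  plane at \<open>x\<close> by at least \<open>\<parallel>\<nabla>f(y) - \<nabla>f(x)\<parallel>\<^sup>2 / (2L)\<close>. Adding the same statement with \<open>x\<close> and \<open>y\<close>
  exchanged gives \<open>\<parallel>\<nabla>f(x) - \<nabla>f(y)\<parallel>\<^sup>2 / L \<le> \<langle>\<nabla>f(x) - \<nabla>f(y), x - y\<rangle>\<close>, and Cauchy--Schwarz finishes.
\<close>

lemma convex_gradient_Lipschitz:
  fixes f :: "'a::real_inner \<Rightarrow> real"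
  assumes conv: "convex_on UNIV f" and grad: "\<And>x. GDERIV f x :> D x"
    and L: "\<And>x y. inner (D x - D y) (x - y) \<le> L * (norm (x - y))\<^sup>2" and "L > 0"
  shows "norm (D x - D y) \<le> L * norm (x - y)"
proof -
  have half: "(norm (D y - D x))\<^sup>2 / (2 * L) \<le> f y - f x - inner (D x) (y - x)" for x y
  proof -
    define e where "e = D y - D x"
    \<comment> \<open>The minimiser of the quadratic upper bound minus the tangent plane.\<close>
    define z where "z = y - (1 / L) *\<^sub>R e"
    have "f x + inner (D x) (z - x) \<le> f y + inner (D y) (z - y) + L / 2 * (norm (z - y))\<^sup>2"
      using convex_above_tangent_plane[OF conv grad, of x z] descent_inequality[OF grad L, of z y]
      by linarith
    moreover have "z - x = (y - x) - (1 / L) *\<^sub>R e" "z - y = - ((1 / L) *\<^sub>R e)"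
      by (simp_all add: z_def)
    ultimately have "inner (D y) e / L - inner (D x) e / L
        \<le> f y - f x - inner (D x) (y - x) + L / 2 * (norm e / L)\<^sup>2"
      using \<open>L > 0\<close> by (simp add: inner_diff_right)
    moreover have "inner (D y) e / L - inner (D x) e / L = (norm e)\<^sup>2 / L"
      by (simp add: e_def power2_norm_eq_inner inner_diff_left diff_divide_distrib)
    moreover have "(norm e)\<^sup>2 / L - L / 2 * (norm e / L)\<^sup>2 = (norm e)\<^sup>2 / (2 * L)"
      using \<open>L > 0\<close> by (simp add: field_simps power2_eq_square)
    ultimately show ?thesis by (simp add: e_def)
  qed
  have "(norm (D x - D y))\<^sup>2 / L = (norm (D y - D x))\<^sup>2 / (2 * L) + (norm (D x - D y))\<^sup>2 / (2 * L)"
    by (simp add: norm_minus_commute)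
  also have "\<dots> \<le> inner (D x - D y) (x - y)"
    using half[where y=y and x=x] half[where y=x and x=y] by (simp add: inner_diff_left inner_diff_right)
  also have "\<dots> \<le> norm (D x - D y) * norm (x - y)"
    by (rule norm_cauchy_schwarz)
  finally have "norm (D x - D y) * norm (D x - D y) \<le> norm (D x - D y) * (L * norm (x - y))"
    using \<open>L > 0\<close> by (simp add: field_simps power2_eq_square)
  then show ?thesis
    using \<open>L > 0\<close> by (cases "D x = D y") simp_all
qed

section \<open>Global solutions of Lipschitz differential equations\<close>

lemma integral_has_vector_derivative_half_line:
  fixes h :: "real \<Rightarrow> 'a::banach"
  assumes "continuous_on {0..} h" and "s \<ge> 0"
  shows "((\<lambda>s. integral {0..s} h) has_vector_derivative h s) (at s within {0..})"
proof -
  have "((\<lambda>s. integral {0..s} h) has_vector_derivative h s) (at s within {0..s + 1})"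
    using assms by (intro integral_has_vector_derivative continuous_on_subset[OF assms(1)]) auto
  moreover have "at s within {0..s + 1} = at s within {0..}"
    by (rule at_within_nhd[where S = "{..<s + 1}"]) auto
  ultimately show ?thesis by simp
qed

text \<open>
  Supplies both the boundedness of the Picard operator and its contraction constant in the
  exponentially weighted norm.
\<close>

lemma weighted_integral_bound:
  fixes h :: "real \<Rightarrow> 'a::banach"
  assumes cont: "continuous_on {0..} h" and bound: "\<And>u. u \<ge> 0 \<Longrightarrow> norm (h u) \<le> C * exp (K * u)"
    and "K > 0" "s \<ge> 0"
  shows "norm (exp (- (K * s)) *\<^sub>R integral {0..s} h) \<le> C / K"
proof -
  have C: "C \<ge> 0" using bound[of 0] by (simp add: order.trans[OF norm_ge_zero])
  have exp_integral: "((\<lambda>u. C * exp (K * u)) has_integral C / K * exp (K * s) - C / K * exp (K * 0)) {0..s}"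
    using \<open>K > 0\<close> \<open>s \<ge> 0\<close>
    by (intro fundamental_theorem_of_calculus)
      (auto simp flip: has_real_derivative_iff_has_vector_derivative intro!: derivative_eq_intros)
  moreover have "h integrable_on {0..s}"
    by (intro integrable_continuous_real continuous_on_subset[OF cont]) auto
  ultimately have "norm (integral {0..s} h) \<le> integral {0..s} (\<lambda>u. C * exp (K * u))"
    using bound by (intro integral_norm_bound_integral) auto
  also have "\<dots> = C / K * exp (K * s) - C / K * exp (K * 0)"
    using exp_integral by (rule integral_unique)
  also have "\<dots> \<le> C / K * exp (K * s)"
    using C \<open>K > 0\<close> by simp
  finally have "exp (- (K * s)) * norm (integral {0..s} h) \<le> exp (- (K * s)) * (C / K * exp (K * s))"
    by (intro mult_left_mono) auto
  then show ?thesis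
    by (simp add: exp_minus field_simps)
qed

text \<open>
  Picard iteration on the whole half-line at once. Writing \<open>y(s) = x\<^sub>0 + exp(Ks) z(s)\<close> with \<open>z\<close> bounded
  puts an exponential weight into the supremum norm; the integral operator then has Lipschitz
  constant \<open>L / K\<close>, independently of the length of the interval, so the choice \<open>K = 2L\<close> makes
  it a contraction.
\<close>

lemma Lipschitz_ode_global_solution:
  fixes V :: "'a::banach \<Rightarrow> 'a"
  assumes Lip: "\<And>u v. norm (V u - V v) \<le> L * norm (u - v)" and "L > 0"
  obtains y where "y 0 = x0"
    and "\<And>s. s \<ge> 0 \<Longrightarrow> (y has_vector_derivative V (y s)) (at s within {0..})"
proof -
  define K where "K = 2 * L"
  have K: "K > 0" using \<open>L > 0\<close> by (simp add: K_def)
  have "L-lipschitz_on UNIV V"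
    using Lip \<open>L > 0\<close> by (auto simp: lipschitz_on_def dist_norm)
  then have contV: "continuous_on UNIV V"
    by (rule lipschitz_on_continuous_on)
  define h where "h z u = V (x0 + exp (K * u) *\<^sub>R apply_bcontfun z u)" for z and u :: real
  have conth: "continuous_on A (h z)" for z A
    unfolding h_def by (intro continuous_on_compose2[OF contV] continuous_intros) auto
  \<comment> \<open>Bounded continuous functions live on the whole line, so \<open>P z\<close> is continued to negative
    arguments by its value at \<open>0\<close>.\<close>
  define P where "P z s = exp (- (K * max 0 s)) *\<^sub>R integral {0..max 0 s} (h z)" for z s
  have "P z \<in> bcontfun" for z
  proof (rule bcontfun_normI)
    have "continuous_on {0..} (\<lambda>s. integral {0..s} (h z))"
      using integral_has_vector_derivative_half_line[OF conth]
      by (auto simp: continuous_on_eq_continuous_within intro: has_vector_derivative_continuous)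
    then have "continuous_on UNIV (\<lambda>s. integral {0..max 0 s} (h z))"
      by (rule continuous_on_compose2) (auto intro!: continuous_intros)
    then show "continuous_on UNIV (P z)"
      unfolding P_def by (intro continuous_intros)
    have "norm (h z u) \<le> (norm (V x0) + L * norm z) * exp (K * u)" if "u \<ge> 0" for u
    proof -
      have "norm (h z u) \<le> norm (V x0) + norm (h z u - V x0)"
        by (rule norm_triangle_sub)
      also have "norm (h z u - V x0) \<le> L * norm (exp (K * u) *\<^sub>R apply_bcontfun z u)"
        unfolding h_def using Lip[of "x0 + exp (K * u) *\<^sub>R apply_bcontfun z u" x0] by simp
      also have "\<dots> \<le> L * (exp (K * u) * norm z)"
        using \<open>L > 0\<close> by (simp add: norm_bounded)
      also have "norm (V x0) \<le> norm (V x0) * exp (K * u)"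
        using K that by (simp add: mult_le_cancel_left1)
      finally show ?thesis by (simp add: algebra_simps)
    qed
    then show "norm (P z s) \<le> (norm (V x0) + L * norm z) / K" for s
      unfolding P_def by (intro weighted_integral_bound conth K) auto
  qed
  then have apply_P: "apply_bcontfun (Bcontfun (P z)) = P z" for z
    by (simp add: Bcontfun_inverse)
  have contraction: "dist (Bcontfun (P z)) (Bcontfun (P w)) \<le> 1 / 2 * dist z w" for z w
  proof (rule dist_bound)
    fix s :: real
    let ?s = "max 0 s"
    have "norm (h z u - h w u) \<le> L * dist z w * exp (K * u)" for u
    proof -
      have "norm (h z u - h w u) \<le> L * norm (exp (K * u) *\<^sub>R (apply_bcontfun z u - apply_bcontfun w u))"
        unfolding h_def by (rule order.trans[OF Lip]) (simp add: scaleR_diff_right)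
      also have "\<dots> \<le> L * (exp (K * u) * dist z w)"
        using \<open>L > 0\<close> dist_bounded[of z u w] by (simp add: dist_norm)
      finally show ?thesis by (simp add: mult_ac)
    qed
    then have "norm (exp (- (K * ?s)) *\<^sub>R integral {0..?s} (\<lambda>u. h z u - h w u)) \<le> L * dist z w / K"
      by (intro weighted_integral_bound continuous_intros conth K) auto
    moreover have "integral {0..?s} (\<lambda>u. h z u - h w u) = integral {0..?s} (h z) - integral {0..?s} (h w)"
      by (intro Henstock_Kurzweil_Integration.integral_diff integrable_continuous_real conth)
    ultimately show "dist (apply_bcontfun (Bcontfun (P z)) s) (apply_bcontfun (Bcontfun (P w)) s)
        \<le> 1 / 2 * dist z w"
      using \<open>L > 0\<close> by (simp add: apply_P P_def dist_norm scaleR_diff_right K_def)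
  qed
  have "\<exists>!z. Bcontfun (P z) = z"
    by (rule banach_fix_type[where c = "1 / 2"]) (use contraction in auto)
  then obtain z where z: "Bcontfun (P z) = z" by auto
  define y where "y s = x0 + exp (K * s) *\<^sub>R apply_bcontfun z s" for s
  have y: "y s = x0 + integral {0..s} (\<lambda>u. V (y u))" if "s \<ge> 0" for s
  proof -
    have "apply_bcontfun z s = exp (- (K * s)) *\<^sub>R integral {0..s} (h z)"
      using apply_P[of z] that by (simp add: z P_def)
    then show ?thesis
      by (simp add: y_def h_def[abs_def] exp_minus)
  qed
  show thesis
  proof (rule that)
    show "y 0 = x0" using y[of 0] by simp
    fix s :: real assume s: "s \<ge> 0"
    have "continuous_on {0..} (\<lambda>u. V (y u))"
      using conth[of "{0..}" z] by (simp add: y_def h_def[abs_def])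
    from integral_has_vector_derivative_half_line[OF this s]
    have "((\<lambda>s. x0 + integral {0..s} (\<lambda>u. V (y u))) has_vector_derivative V (y s)) (at s within {0..})"
      by (auto intro!: derivative_eq_intros)
    then show "(y has_vector_derivative V (y s)) (at s within {0..})"
      by (rule has_vector_derivative_transform[rotated 2]) (use s y in auto)
  qed
qed

section \<open>The gradient flow of a convex function\<close>

lemma squared_distance_derivative:
  fixes y :: "real \<Rightarrow> 'a::real_inner"
  assumes "(y has_vector_derivative v) (at s within S)"
  shows "((\<lambda>s. (norm (y s - z))\<^sup>2) has_real_derivative 2 * inner v (y s - z)) (at s within S)"
proof -
  have "GDERIV (\<lambda>u. (norm (u - z))\<^sup>2) (y s) :> 2 *\<^sub>R (y s - z)"
    unfolding gderiv_def power2_norm_eq_inner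
    by (auto intro!: derivative_eq_intros simp: inner_commute)
  from GDERIV_chain_within[OF this assms] show ?thesis by simp
qed

text \<open>
  The one-sided condition limits the rate at which the squared distance to a stationary point can
  shrink: its derivative is at least \<open>- 2L\<close> times its value. A flow that starts away from such a
  point therefore never arrives there in finite time.
\<close>

lemma gradient_flow_distance_lower_bound:
  fixes y :: "real \<Rightarrow> 'a::real_inner"
  assumes flow: "\<And>s. s \<ge> 0 \<Longrightarrow> (y has_vector_derivative - D (y s)) (at s within {0..})"
    and L: "\<And>x y. inner (D x - D y) (x - y) \<le> L * (norm (x - y))\<^sup>2"
    and "D z = 0" and "s \<ge> 0"
  shows "exp (- (2 * L * s)) * (norm (y 0 - z))\<^sup>2 \<le> (norm (y s - z))\<^sup>2"
proof -
  let ?e = "\<lambda>s. exp (2 * L * s)"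
  let ?d = "\<lambda>s. (norm (y s - z))\<^sup>2"
  have "- (?e s * ?d s) \<le> - (?e 0 * ?d 0)"
  proof (rule nonincreasing_half_line[where g = "\<lambda>s. - (?e s * ?d s)"])
    fix s :: real assume s: "s \<ge> 0"
    note [derivative_intros] = squared_distance_derivative[OF flow[OF s]]
    show "((\<lambda>s. - (?e s * ?d s)) has_real_derivative
        - (?e s * (2 * L * ?d s - 2 * inner (D (y s)) (y s - z)))) (at s within {0..})"
      by (auto intro!: derivative_eq_intros simp: algebra_simps)
    show "- (?e s * (2 * L * ?d s - 2 * inner (D (y s)) (y s - z))) \<le> 0"
      using L[of "y s" z] \<open>D z = 0\<close> by simp
  qed (use \<open>s \<ge> 0\<close> in auto)
  then show ?thesis
    by (simp add: exp_minus field_simps)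
qed

text \<open>
  The distance of the flow to \<^emph>\<open>every\<close> minimum point is nonincreasing, because
  \<open>\<langle>\<nabla>f(y), y - q\<rangle> \<ge> f(y) - f(q) \<ge> 0\<close>. So the flow is bounded and has an accumulation point \<open>p\<close>. The
  Lyapunov function \<open>\<parallel>y(s) - z\<parallel>\<^sup>2 + 2s (f(y(s)) - f(z))\<close> shows that \<open>f(y(s))\<close> tends to the minimum, so
  \<open>p\<close> is itself a minimum point; monotonicity of the distance to \<open>p\<close> turns accumulation into
  convergence.
\<close>

lemma gradient_flow_converges:
  fixes f :: "'a::euclidean_space \<Rightarrow> real"
  assumes conv: "convex_on UNIV f" and grad: "\<And>x. GDERIV f x :> D x"
    and flow: "\<And>s. s \<ge> 0 \<Longrightarrow> (y has_vector_derivative - D (y s)) (at s within {0..})"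
    and z: "global_min_point f z"
  obtains p where "global_min_point f p" and "(y \<longlongrightarrow> p) at_top"
proof -
  have min_le: "f q \<le> f v" if "global_min_point f q" for q v
    using that by (simp add: is_arg_min_linorder)
  have df: "((\<lambda>s. f (y s)) has_real_derivative - (norm (D (y s)))\<^sup>2) (at s within {0..})"
    if "s \<ge> 0" for s
    using GDERIV_chain_within[OF grad flow[OF that]] by (simp add: power2_norm_eq_inner)
  have gap: "f (y s) - f q \<le> inner (D (y s)) (y s - q)" for s q
    using convex_above_tangent_plane[OF conv grad, of "y s" q] by (simp add: inner_diff_right)
  have closer: "(norm (y b - q))\<^sup>2 \<le> (norm (y a - q))\<^sup>2"
    if q: "global_min_point f q" and "0 \<le> a" "a \<le> b" for q a b
  proof (rule nonincreasing_half_line[where g = "\<lambda>s. (norm (y s - q))\<^sup>2"])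
    show "((\<lambda>s. (norm (y s - q))\<^sup>2) has_real_derivative 2 * inner (- D (y s)) (y s - q))
        (at s within {0..})" if "s \<ge> 0" for s
      by (rule squared_distance_derivative[OF flow[OF that]])
    show "2 * inner (- D (y s)) (y s - q) \<le> 0" for s
      using gap[of s q] min_le[OF q, of "y s"] by simp
  qed (use that in auto)
  have rate: "2 * s * (f (y s) - f z) \<le> (norm (y 0 - z))\<^sup>2" if "s \<ge> 0" for s
  proof -
    let ?E = "\<lambda>s. (norm (y s - z))\<^sup>2 + 2 * s * (f (y s) - f z)"
    have "?E s \<le> ?E 0"
    proof (rule nonincreasing_half_line[where g = ?E])
      fix s :: real assume s: "s \<ge> 0"
      note [derivative_intros] = squared_distance_derivative[OF flow[OF s]] df[OF s]
      show "(?E has_real_derivative 2 * inner (- D (y s)) (y s - z) + 2 * (f (y s) - f z)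
          - 2 * s * (norm (D (y s)))\<^sup>2) (at s within {0..})"
        by (auto intro!: derivative_eq_intros)
      show "2 * inner (- D (y s)) (y s - z) + 2 * (f (y s) - f z) - 2 * s * (norm (D (y s)))\<^sup>2 \<le> 0"
      proof -
        have "2 * inner (- D (y s)) (y s - z) + 2 * (f (y s) - f z) \<le> 0"
          using gap[of s z] by simp
        moreover have "0 \<le> 2 * s * (norm (D (y s)))\<^sup>2" using s by simp
        ultimately show ?thesis
          unfolding diff_le_0_iff_le by (rule order.trans)
      qed
    qed (use that in auto)
    then show ?thesis by (simp add: order.trans[rotated])
  qed
  have "bounded (range (\<lambda>n. y (real n)))"
  proof (rule boundedI)
    fix v assume "v \<in> range (\<lambda>n. y (real n))"
    then obtain n where v: "v = y (real n)" by auto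
    have "norm (v - z) \<le> norm (y 0 - z)"
      using closer[OF z, of 0 "real n"] by (simp add: v power2_le_iff_abs_le)
    then show "norm v \<le> norm (y 0 - z) + norm z"
      using norm_triangle_sub[of v z] by linarith
  qed
  from bounded_imp_convergent_subsequence[OF this]
  obtain p r where r: "strict_mono r" and "((\<lambda>n. y (real n)) \<circ> r) \<longlonglongrightarrow> p"
    by blast
  then have yr: "(\<lambda>n. y (real (r n))) \<longlonglongrightarrow> p" by (simp add: o_def)
  have "f p \<le> f z"
  proof -
    have "isCont f p"
      using grad[of p] by (auto simp: gderiv_def intro: has_derivative_continuous)
    then have "(\<lambda>n. f (y (real (r n)))) \<longlonglongrightarrow> f p"
      using yr by (rule isCont_tendsto_compose)
    moreover have "(\<lambda>n. f z + (norm (y 0 - z))\<^sup>2 / 2 * inverse (real (r n))) \<longlonglongrightarrow> f z + (norm (y 0 - z))\<^sup>2 / 2 * 0"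
      using LIMSEQ_subseq_LIMSEQ[OF lim_inverse_n r]
      by (intro tendsto_intros) (simp add: o_def)
    moreover have "\<forall>\<^sub>F n in sequentially. f (y (real (r n))) \<le> f z + (norm (y 0 - z))\<^sup>2 / 2 * inverse (real (r n))"
      using eventually_gt_at_top[of 0]
    proof eventually_elim
      case (elim n)
      then have "r n > 0" using seq_suble[OF r, of n] by linarith
      with rate[of "real (r n)"] show ?case by (simp add: field_simps)
    qed
    ultimately show ?thesis
      using tendsto_le[OF sequentially_bot] by fastforce
  qed
  then have p: "global_min_point f p"
    using min_le[OF z] by (auto simp: is_arg_min_linorder intro: order.trans)
  have "(y \<longlongrightarrow> p) at_top"
  proof (rule tendstoI)
    fix e :: real assume "e > 0"
    then obtain n where n: "norm (y (real (r n)) - p) < e"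
      using yr[THEN LIMSEQ_D] by blast
    show "\<forall>\<^sub>F s in at_top. dist (y s) p < e"
      using eventually_ge_at_top[of "real (r n)"]
    proof eventually_elim
      case (elim s)
      then have "norm (y s - p) \<le> norm (y (real (r n)) - p)"
        using closer[OF p, of "real (r n)" s] by (simp add: power2_le_iff_abs_le)
      with n show ?case by (simp add: dist_norm)
    qed
  qed
  with p that show ?thesis by blast
qed

section \<open>The normalised gradient method\<close>

text \<open>
  The trajectory is the gradient flow, run with the loss \<open>(f(x\<^sub>0) - f) / \<rho>\<close> as the clock and stopped
  at its limit. Starting at a minimum point is separate, since there the clock never advances.
\<close>

lemma gradient_trajectory_exists:
  fixes f :: "'a::euclidean_space \<Rightarrow> real"
  assumes conv: "convex_on UNIV f" and z: "global_min_point f z"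
    and "L > 0" and cont_grad: "L_continuous_gradient L f" and "\<rho> > 0"
  shows "\<exists>x. gradient_trajectory \<rho> f x0 x"
proof (cases "global_min_point f x0")
  case True
  then have "gradient_trajectory \<rho> f x0 (\<lambda>_. x0)"
    by (auto simp: gradient_trajectory_def)
  then show ?thesis by blast
next
  case False
  let ?D = "gradient f"
  have grad: "GDERIV f x :> ?D x" for x
    using cont_grad gradient_eqI unfolding L_continuous_gradient_def by metis
  have L: "inner (?D x - ?D y) (x - y) \<le> L * (norm (x - y))\<^sup>2" for x y
    using cont_grad by (simp add: L_continuous_gradient_def)
  have "norm (- ?D u - - ?D v) \<le> L * norm (u - v)" for u v
    using convex_gradient_Lipschitz[OF conv grad L \<open>L > 0\<close>, of v u] by (simp add: norm_minus_commute)
  from Lipschitz_ode_global_solution[OF this \<open>L > 0\<close>]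
  obtain y where y0: "y 0 = x0"
    and flow: "\<And>s. s \<ge> 0 \<Longrightarrow> (y has_vector_derivative - ?D (y s)) (at s within {0..})"
    by blast
  from gradient_flow_converges[OF conv grad flow z]
  obtain p where p: "global_min_point f p" and yp: "(y \<longlongrightarrow> p) at_top" by blast
  have D_nz: "?D (y s) \<noteq> 0" if "s \<ge> 0" for s
  proof
    assume D0: "?D (y s) = 0"
    from gradient_flow_distance_lower_bound[OF flow L D0 that] have "y 0 = y s"
      by (simp add: mult_le_0_iff)
    with False D0 y0 stationary_point_iff_minimum[OF conv grad] show False by simp
  qed
  define g where "g s = (f x0 - f (y s)) / \<rho>" for s
  define T where "T = (f x0 - f p) / \<rho>"
  have dg: "(g has_real_derivative (norm (?D (y s)))\<^sup>2 / \<rho>) (at s within {0..})" if "s \<ge> 0" for s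
    unfolding g_def using GDERIV_chain_within[OF grad flow[OF that]] \<open>\<rho> > 0\<close>
    by (auto intro!: derivative_eq_intros simp: power2_norm_eq_inner)
  have g_pos: "(norm (?D (y s)))\<^sup>2 / \<rho> > 0" if "s \<ge> 0" for s
    using D_nz[OF that] \<open>\<rho> > 0\<close> by simp
  have g0: "g 0 = 0" by (simp add: g_def y0)
  have "isCont f p"
    using grad[of p] by (auto simp: gderiv_def intro: has_derivative_continuous)
  then have g_lim: "(g \<longlongrightarrow> T) at_top"
    unfolding g_def T_def by (intro tendsto_intros isCont_tendsto_compose[OF _ yp]) (use \<open>\<rho> > 0\<close> in auto)
  from increasing_half_line_inverse[OF dg g_pos g0 g_lim]
  obtain \<sigma> where \<sigma>0: "\<And>t. t \<in> {0..<T} \<Longrightarrow> \<sigma> t \<ge> 0"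
    and \<sigma>g: "\<And>s. s \<ge> 0 \<Longrightarrow> \<sigma> (g s) = s"
    and d\<sigma>: "\<And>t. t \<in> {0..<T} \<Longrightarrow>
      (\<sigma> has_real_derivative inverse ((norm (?D (y (\<sigma> t))))\<^sup>2 / \<rho>)) (at t within {0..<T})"
    and \<sigma>_lim: "filterlim \<sigma> at_top (at T within {0..<T})"
    by blast
  define x where "x t = (if t < T then y (\<sigma> t) else p)" for t
  have "f p < f x0"
    using False p by (force simp: is_arg_min_linorder not_le intro: order.strict_trans1)
  then have T: "T > 0" using \<open>\<rho> > 0\<close> by (simp add: T_def)
  have dx: "(x has_vector_derivative - (\<rho> *\<^sub>R (?D (x t) /\<^sub>R (norm (?D (x t)))\<^sup>2))) (at t within {0..})"
    if t: "t \<in> {0..<T}" for t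
  proof -
    have "((y \<circ> \<sigma>) has_vector_derivative
        inverse ((norm (?D (y (\<sigma> t))))\<^sup>2 / \<rho>) *\<^sub>R - ?D (y (\<sigma> t))) (at t within {0..<T})"
    proof (rule vector_diff_chain_within)
      show "(\<sigma> has_vector_derivative inverse ((norm (?D (y (\<sigma> t))))\<^sup>2 / \<rho>)) (at t within {0..<T})"
        using d\<sigma>[OF t] by (simp add: has_real_derivative_iff_has_vector_derivative)
      show "(y has_vector_derivative - ?D (y (\<sigma> t))) (at (\<sigma> t) within \<sigma> ` {0..<T})"
        by (rule has_vector_derivative_within_subset[OF flow]) (use \<sigma>0 t in auto)
    qed
    then have "(x has_vector_derivative
        inverse ((norm (?D (y (\<sigma> t))))\<^sup>2 / \<rho>) *\<^sub>R - ?D (y (\<sigma> t))) (at t within {0..<T})"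
      by (rule has_vector_derivative_transform[rotated 2]) (use t in \<open>auto simp: x_def\<close>)
    moreover have "at t within {0..<T} = at t within {0..}"
      by (rule at_within_nhd[where S = "{..<T}"]) (use t in auto)
    ultimately show ?thesis
      using t by (simp add: x_def divide_inverse mult.commute)
  qed
  have "continuous_on {0..} x"
  proof (rule continuous_on_closed_Un[where s = "{0..T}" and t = "{T..}", THEN continuous_on_subset])
    have "continuous (at t within {0..T}) x" if "t \<in> {0..T}" for t
    proof (cases "t = T")
      case True
      have "(x \<longlongrightarrow> p) (at T within {0..<T})"
        using filterlim_compose[OF yp \<sigma>_lim]
        by (rule Lim_transform_eventually) (auto simp: eventually_at_filter x_def)
      moreover have "{0..<T} - {T} = {0..T} - {T}" by auto
      then have "at T within {0..<T} = at T within {0..T}"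
        by (simp add: at_within_def)
      ultimately show ?thesis
        unfolding True by (simp add: continuous_within x_def)
    next
      case False
      with that dx[of t] have "continuous (at t within {0..}) x"
        by (auto intro: has_vector_derivative_continuous)
      then show ?thesis
        by (rule continuous_within_subset) auto
    qed
    then show "continuous_on {0..T} x"
      by (simp add: continuous_on_eq_continuous_within)
    show "continuous_on {T..} x"
      by (rule continuous_on_eq[OF continuous_on_const[of _ p]]) (auto simp: x_def)
  qed auto
  moreover have "t \<in> {0..<T}" if "t \<ge> 0" "\<forall>s\<in>{0..t}. \<not> global_min_point f (x s)" for t
  proof (rule ccontr)
    assume "t \<notin> {0..<T}"
    with that have "\<not> global_min_point f (x T)" using T by auto
    with p show False by (simp add: x_def)
  qed
  moreover have "x 0 = x0"
    using T \<sigma>g[of 0] by (simp add: x_def g0 y0)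
  ultimately have "gradient_trajectory \<rho> f x0 x"
    unfolding gradient_trajectory_def using dx by blast
  then show ?thesis by blast
qed

text \<open>
  As long as no minimum point is met, \<open>f(x(t)) + \<rho> t\<close> is constant, which would make \<open>f(x(t))\<close> smaller
  than the minimum eventually.
\<close>

lemma gradient_trajectory_reaches_minimum:
  fixes f :: "'a::real_inner \<Rightarrow> real"
  assumes conv: "convex_on UNIV f" and z: "global_min_point f z"
    and grad: "\<And>x. GDERIV f x :> gradient f x" and "\<rho> > 0"
    and traj: "gradient_trajectory \<rho> f x0 x"
  shows "\<exists>T\<ge>0. global_min_point f (x T)"
proof (rule ccontr)
  assume "\<not> ?thesis"
  then have never: "\<not> global_min_point f (x t)" if "t \<ge> 0" for t
    using that by blast
  let ?D = "gradient f"
  have deriv: "((\<lambda>t. f (x t) + \<rho> * t) has_real_derivative 0) (at t within {0..})"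
    if t: "t \<ge> 0" for t
  proof -
    have "(x has_vector_derivative - (\<rho> *\<^sub>R (?D (x t) /\<^sub>R (norm (?D (x t)))\<^sup>2))) (at t within {0..})"
      using traj never t by (simp add: gradient_trajectory_def)
    note [derivative_intros] = GDERIV_chain_within[OF grad this]
    have "?D (x t) \<noteq> 0"
      using never[OF t] stationary_point_iff_minimum[OF conv grad] by blast
    then show ?thesis
      by (auto intro!: derivative_eq_intros simp: power2_norm_eq_inner)
  qed
  \<comment> \<open>One unit after the time at which \<open>f\<close> would have come down to its minimum.\<close>
  define T where "T = (f x0 - f z) / \<rho> + 1"
  have "f z \<le> f x0" using z by (simp add: is_arg_min_linorder)
  then have "T \<ge> 0" using \<open>\<rho> > 0\<close> by (simp add: T_def)
  have "f (x T) + \<rho> * T \<le> f (x 0) + \<rho> * 0"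
    by (rule nonincreasing_half_line[where g = "\<lambda>t. f (x t) + \<rho> * t", OF deriv]) (use \<open>T \<ge> 0\<close> in auto)
  moreover have "x 0 = x0" using traj by (simp add: gradient_trajectory_def)
  moreover have "\<rho> * T = f x0 - f z + \<rho>"
    using \<open>\<rho> > 0\<close> by (simp add: T_def field_simps)
  ultimately have "f (x T) < f z" using \<open>\<rho> > 0\<close> by simp
  with z show False by (simp add: is_arg_min_linorder not_le[symmetric])
qed

theorem theorem1:
  fixes f :: "real ^ 'n \<Rightarrow> real" and xstar :: "real ^ 'n" and L \<rho> :: real
  assumes "convex_on UNIV f"
    and "global_min_point f xstar"
    and "L > 0" and "L_continuous_gradient L f"
    and "\<rho> > 0"
  shows "\<forall>x0. (\<exists>x. gradient_trajectory \<rho> f x0 x) \<and>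
           (\<forall>x. gradient_trajectory \<rho> f x0 x \<longrightarrow>
              (\<exists>T\<ge>0. global_min_point f (x T) \<and>
                 ((\<forall>z. global_min_point f z \<longrightarrow> z = xstar) \<longrightarrow> x T = xstar)))"
proof (intro allI conjI impI)
  fix x0
  show "\<exists>x. gradient_trajectory \<rho> f x0 x"
    using assms by (rule gradient_trajectory_exists)
next
  fix x0 x assume traj: "gradient_trajectory \<rho> f x0 x"
  have grad: "GDERIV f x :> gradient f x" for x
    using assms(4) gradient_eqI unfolding L_continuous_gradient_def by metis
  from gradient_trajectory_reaches_minimum[OF assms(1,2) grad assms(5) traj]
  show "\<exists>T\<ge>0. global_min_point f (x T) \<and>
      ((\<forall>z. global_min_point f z \<longrightarrow> z = xstar) \<longrightarrow> x T = xstar)"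
    by blast
qed

end
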